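(* A finite simple graph $G$ is claw-free (i.e., contains no induced subgraph isomorphic to the claw $K_{1,3}$) if and only if $G$ and all of its induced subgraphs are strongly nice.
   Context: For a finite simple graph $G$ with vertex set $\{v_1,\ldots,v_d\}$, its chromatic symmetric function is $X_G=\sum_\kappa x_{\kappa(v_1)}\cdots x_{\kappa(v_d)}$, summing over all proper colorings $\kappa:V(G)\to\{1,2,\ldots\}$ (i.e., $\kappa(u)\ne\kappa(v)$ for every edge $uv$). For a partition $\lambda$, $m_\lambda$ is the monomial symmetric function and $[m_\lambda]X_G$ the coefficient of $m_\lambda$ in $X_G$; equivalently, $[m_\lambda]X_G$ equals the number of semi-ordered stable partitions of $G$ of type $\lambda$ (set partitions of $V(G)$ into stable sets, where blocks of equal size are additionally ordered, and the type is the multiset of block sizes arranged in weakly decreasing order). For partitions $\lambda,\mu$ of the same integer, $\mu\le\lambda$ in dominance order means $\sum_{i=1}^k\mu_i\le\sum_{i=1}^k\lambda_i$ for all $k\ge 1$. A graph $G$ is strongly nice if $[m_\mu]X_G\ge[m_\lambda]X_G$ whenever $\mu\le\lambda$ in dominance order. *)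

theory Defs
  imports "Graph_Theory.Graph_Theory" "HOL-Library.Multiset" "HOL-Library.FuncSet"
begin

text \<open>
  Finite simple graphs are the loop-free symmetric digraphs without parallel arcs of the locale
  \<^locale>\<open>graph\<close>: an edge \<open>uv\<close> is the pair of arcs \<open>(u,v)\<close>, \<open>(v,u)\<close>.
\<close>

definition claw_free :: "('a, 'b) pre_digraph \<Rightarrow> bool" where
  "claw_free G \<longleftrightarrow> \<not> (\<exists>H. induced_subgraph H G \<and> K\<^bsub>1,3\<^esub> H)"

definition proper_colorings :: "('a, 'b) pre_digraph \<Rightarrow> ('a \<Rightarrow> nat) set" where
  "proper_colorings G =
     {\<kappa> \<in> verts G \<rightarrow>\<^sub>E {1..}. \<forall>(u, v) \<in> arcs_ends G. \<kappa> u \<noteq> \<kappa> v}"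

text \<open>
  A monomial in the variables \<open>x\<^sub>1, x\<^sub>2, \<dots>\<close> is the multiset of the indices of its factors (an
  exponent is a multiplicity, the degree is the size). A formal power series is the function that
  sends a monomial to its coefficient. The index 0 does not occur: both series below vanish on
  multisets that contain it.
\<close>

type_synonym power_series = "nat multiset \<Rightarrow> int"

definition chromatic_symmetric_function :: "('a, 'b) pre_digraph \<Rightarrow> power_series" where
  "chromatic_symmetric_function G = (\<lambda>M.
     int (card {\<kappa> \<in> proper_colorings G. image_mset \<kappa> (mset_set (verts G)) = M}))"

definition is_partition :: "nat list \<Rightarrow> bool" where
  "is_partition \<nu> \<longleftrightarrow> sorted_wrt (\<ge>) \<nu> \<and> (\<forall>p \<in> set \<nu>. 0 < p)"

definition dominance_le :: "nat list \<Rightarrow> nat list \<Rightarrow> bool" where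
  "dominance_le \<mu> \<nu> \<longleftrightarrow> sum_list \<mu> = sum_list \<nu> \<and>
     (\<forall>k \<ge> 1. sum_list (take k \<mu>) \<le> sum_list (take k \<nu>))"

definition exponents :: "nat multiset \<Rightarrow> nat multiset" where
  "exponents M = image_mset (count M) (mset_set (set_mset M))"

definition monomial_symmetric_function :: "nat list \<Rightarrow> power_series" where
  "monomial_symmetric_function \<nu> = (\<lambda>M.
     if set_mset M \<subseteq> {1..} \<and> exponents M = mset \<nu> then 1 else 0)"

text \<open>
  \<open>m_expansion f c\<close> says \<open>f = \<Sum>\<nu>. c \<nu> * m\<^sub>\<nu>\<close>, the sum over all partitions being taken
  coefficientwise: a given monomial occurs in at most one \<open>m\<^sub>\<nu>\<close>.
\<close>

definition m_expansion :: "power_series \<Rightarrow> (nat list \<Rightarrow> int) \<Rightarrow> bool" where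
  "m_expansion f c \<longleftrightarrow> (\<forall>M. f M =
     (\<Sum>\<nu> | is_partition \<nu> \<and> monomial_symmetric_function \<nu> M \<noteq> 0.
        c \<nu> * monomial_symmetric_function \<nu> M))"

definition m_coeff :: "nat list \<Rightarrow> power_series \<Rightarrow> int" where
  "m_coeff \<nu> f = (THE a. \<exists>c. m_expansion f c \<and> c \<nu> = a)"

definition strongly_nice :: "('a, 'b) pre_digraph \<Rightarrow> bool" where
  "strongly_nice G \<longleftrightarrow> (\<forall>\<nu> \<mu>. is_partition \<nu> \<and> is_partition \<mu> \<and> dominance_le \<mu> \<nu> \<longrightarrow>
     m_coeff \<mu> (chromatic_symmetric_function G) \<ge> m_coeff \<nu> (chromatic_symmetric_function G))"


text \<open>
  The description in \<^const>\<open>m_coeff\<close> is well defined for chromatic symmetric functions, with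
  value the coefficient of \<open>x\<^sub>1\<^bsup>\<nu>\<^sub>1\<^esup> x\<^sub>2\<^bsup>\<nu>\<^sub>2\<^esup> \<dots>\<close>.
\<close>

definition leading_monomial :: "nat list \<Rightarrow> nat multiset" where
  "leading_monomial \<nu> = (\<Sum>i<length \<nu>. replicate_mset (\<nu> ! i) (Suc i))"

lemma count_leading_monomial:
  "count (leading_monomial \<nu>) j = (if 1 \<le> j \<and> j \<le> length \<nu> then \<nu> ! (j - 1) else 0)"
proof (cases j)
  case 0
  then show ?thesis by (simp add: leading_monomial_def count_sum)
next
  case (Suc i)
  have "count (leading_monomial \<nu>) j = (\<Sum>k<length \<nu>. if k = i then \<nu> ! k else 0)"
    by (auto simp: leading_monomial_def count_sum Suc intro!: sum.cong)
  then show ?thesis by (auto simp: Suc)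
qed

lemma set_leading_monomial:
  assumes "is_partition \<nu>"
  shows "set_mset (leading_monomial \<nu>) = Suc ` {..<length \<nu>}"
proof -
  have "count (leading_monomial \<nu>) j > 0 \<longleftrightarrow> 1 \<le> j \<and> j \<le> length \<nu>" for j
    using assms by (auto simp: count_leading_monomial is_partition_def)
  then have "j \<in># leading_monomial \<nu> \<longleftrightarrow> 1 \<le> j \<and> j \<le> length \<nu>" for j
    by (simp add: count_greater_zero_iff [symmetric] del: count_greater_zero_iff)
  moreover have "j \<in> Suc ` {..<length \<nu>} \<longleftrightarrow> 1 \<le> j \<and> j \<le> length \<nu>" for j
    by (cases j) auto
  ultimately show ?thesis by blast
qed

lemma exponents_leading_monomial:
  assumes "is_partition \<nu>"
  shows "exponents (leading_monomial \<nu>) = mset \<nu>"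
proof -
  have "exponents (leading_monomial \<nu>) =
      image_mset (count (leading_monomial \<nu>)) (image_mset Suc (mset_set {..<length \<nu>}))"
    by (simp add: exponents_def set_leading_monomial [OF assms] image_mset_mset_set)
  also have "\<dots> = image_mset ((!) \<nu>) (mset_set {..<length \<nu>})"
    by (auto simp: multiset.map_comp count_leading_monomial intro!: image_mset_cong)
  also have "\<dots> = mset (map ((!) \<nu>) [0..<length \<nu>])"
    by (metis mset_map mset_set_upto_eq_mset_upto)
  finally show ?thesis by (simp add: map_nth)
qed

lemma is_partition_mset_inj:
  assumes "is_partition \<nu>" "is_partition \<mu>" "mset \<nu> = mset \<mu>"
  shows "\<nu> = \<mu>"
proof -
  have "sorted (rev \<nu>)" "sorted (rev \<mu>)"
    using assms by (simp_all add: is_partition_def sorted_wrt_rev)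
  moreover have "mset (rev \<nu>) = mset (rev \<mu>)" using assms by simp
  ultimately have "rev \<nu> = rev \<mu>" by (metis properties_for_sort)
  then show ?thesis by simp
qed

lemma m_expansion_sum:
  assumes "is_partition \<nu>" "set_mset M \<subseteq> {1..}" "exponents M = mset \<nu>"
  shows "(\<Sum>\<mu> | is_partition \<mu> \<and> monomial_symmetric_function \<mu> M \<noteq> 0.
           c \<mu> * monomial_symmetric_function \<mu> M) = c \<nu>"
proof -
  have "{\<mu>. is_partition \<mu> \<and> monomial_symmetric_function \<mu> M \<noteq> 0} = {\<nu>}"
    using assms by (auto simp: monomial_symmetric_function_def intro: is_partition_mset_inj)
  then show ?thesis using assms by (simp add: monomial_symmetric_function_def)
qed

lemma m_expansion_coeff:
  assumes "m_expansion f c" "is_partition \<nu>"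
  shows "c \<nu> = f (leading_monomial \<nu>)"
proof -
  have "set_mset (leading_monomial \<nu>) \<subseteq> {1..}"
    using set_leading_monomial [OF assms(2)] by auto
  from m_expansion_sum [OF assms(2) this exponents_leading_monomial [OF assms(2)]]
  show ?thesis using assms(1) by (simp add: m_expansion_def)
qed

lemma image_mset_eq_bij:
  assumes "finite A" "finite B" "image_mset f (mset_set A) = image_mset g (mset_set B)"
  shows "\<exists>h. bij_betw h A B \<and> (\<forall>x\<in>A. g (h x) = f x)"
  using assms
proof (induction A arbitrary: B rule: finite_induct)
  case empty
  then have "B = {}" by (simp add: mset_set_empty_iff)
  then show ?case by (simp add: bij_betw_def)
next
  case (insert a A)
  have "f a \<in># image_mset g (mset_set B)"
    by (metis insert.hyps insert.prems(2) finite.insertI finite_set_mset_mset_set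
        image_eqI insertI1 set_image_mset)
  then obtain b where b: "b \<in> B" "g b = f a" using insert.prems by auto
  have "mset_set B = add_mset b (mset_set (B - {b}))"
    using b insert.prems by (metis mset_set.remove)
  then have "image_mset f (mset_set A) = image_mset g (mset_set (B - {b}))"
    using insert b by simp
  then obtain h where h: "bij_betw h A (B - {b})" "\<forall>x\<in>A. g (h x) = f x"
    using insert.IH [of "B - {b}"] insert.prems by auto
  have "bij_betw (h(a := b)) A (B - {b})"
    using h(1) insert.hyps by (subst bij_betw_cong [of _ _ h]) auto
  then have "bij_betw (h(a := b)) (A \<union> {a}) ((B - {b}) \<union> {b})"
    using bij_betw_combine [of "h(a := b)" A "B - {b}" "{a}" "{b}"] by (simp add: bij_betw_def)
  moreover have "A \<union> {a} = insert a A" "(B - {b}) \<union> {b} = B" using b by auto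
  ultimately have "bij_betw (h(a := b)) (insert a A) B" by metis
  moreover have "\<forall>x\<in>insert a A. g ((h(a := b)) x) = f x" using h(2) b insert.hyps by simp
  ultimately show ?case by blast
qed

lemma chromatic_symmetric_function_le:
  assumes G: "graph G" and "set_mset N \<subseteq> {1..}" and ex: "exponents M = exponents N"
  shows "chromatic_symmetric_function G M \<le> chromatic_symmetric_function G N"
proof -
  interpret graph G by fact
  let ?C = "\<lambda>M. {\<kappa> \<in> proper_colorings G. image_mset \<kappa> (mset_set (verts G)) = M}"
  obtain h where h: "bij_betw h (set_mset M) (set_mset N)" "\<forall>x\<in>#M. count N (h x) = count M x"
    using image_mset_eq_bij [of "set_mset M" "set_mset N" "count M" "count N"] ex
    by (auto simp: exponents_def)
  have hM: "image_mset h M = N"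
  proof (rule multiset_eqI)
    fix y
    show "count (image_mset h M) y = count N y"
    proof (cases "y \<in># N")
      case True
      then obtain x where x: "x \<in># M" "y = h x" using h(1) by (auto simp: bij_betw_def)
      then have "h -` {y} \<inter> set_mset M = {x}"
        using h(1) by (auto simp: bij_betw_def dest: inj_onD)
      then show ?thesis using h(2) x by (simp add: count_image_mset)
    next
      case False
      then have "y \<notin># image_mset h M" using h(1) by (auto simp: bij_betw_def)
      then show ?thesis using False by (metis count_eq_zero_iff)
    qed
  qed
  have img: "\<kappa> v \<in># L" if "\<kappa> \<in> ?C L" "v \<in> verts G" for \<kappa> v L
    using that by auto
  have fin: "finite (?C N)"
  proof (rule finite_subset)
    show "?C N \<subseteq> verts G \<rightarrow>\<^sub>E set_mset N" by (auto simp: proper_colorings_def PiE_def)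
  qed (auto intro: finite_PiE)
  let ?F = "\<lambda>\<kappa>. restrict (h \<circ> \<kappa>) (verts G)"
  have "inj_on ?F (?C M)"
  proof (rule inj_onI)
    fix \<kappa> \<kappa>' assume k: "\<kappa> \<in> ?C M" "\<kappa>' \<in> ?C M" and eq: "?F \<kappa> = ?F \<kappa>'"
    show "\<kappa> = \<kappa>'"
    proof (rule PiE_ext)
      show "\<kappa> \<in> verts G \<rightarrow>\<^sub>E {1..}" "\<kappa>' \<in> verts G \<rightarrow>\<^sub>E {1..}"
        using k by (auto simp: proper_colorings_def)
    next
      fix v assume v: "v \<in> verts G"
      have "h (\<kappa> v) = h (\<kappa>' v)" using fun_cong [OF eq, of v] v by simp
      then show "\<kappa> v = \<kappa>' v"
        using img [OF k(1) v] img [OF k(2) v] h(1) by (auto simp: bij_betw_def dest: inj_onD)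
    qed
  qed
  moreover have "?F ` ?C M \<subseteq> ?C N"
  proof
    fix \<kappa>' assume "\<kappa>' \<in> ?F ` ?C M"
    then obtain \<kappa> where k: "\<kappa> \<in> ?C M" and k': "\<kappa>' = ?F \<kappa>" by blast
    have "image_mset \<kappa>' (mset_set (verts G)) = image_mset h (image_mset \<kappa> (mset_set (verts G)))"
      unfolding k' by (auto simp: multiset.map_comp intro!: image_mset_cong)
    then have "image_mset \<kappa>' (mset_set (verts G)) = N" using k hM by simp
    moreover have "\<kappa>' \<in> verts G \<rightarrow>\<^sub>E {1..}"
    proof -
      have "h (\<kappa> v) \<in> {1..}" if "v \<in> verts G" for v
        using img [OF k that] h(1) assms(2) by (auto simp: bij_betw_def)
      then show ?thesis by (auto simp: k')
    qed
    moreover have "\<kappa>' u \<noteq> \<kappa>' v" if "(u, v) \<in> arcs_ends G" for u v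
    proof -
      have uv: "u \<in> verts G" "v \<in> verts G" using that by (auto simp: arcs_ends_conv)
      have "\<kappa> u \<noteq> \<kappa> v" using k that by (auto simp: proper_colorings_def)
      then have "h (\<kappa> u) \<noteq> h (\<kappa> v)"
        using img [OF k uv(1)] img [OF k uv(2)] h(1) by (auto simp: bij_betw_def dest: inj_onD)
      then show ?thesis using uv by (simp add: k')
    qed
    ultimately show "\<kappa>' \<in> ?C N" by (auto simp: proper_colorings_def)
  qed
  ultimately have "card (?C M) \<le> card (?C N)" using fin by (rule card_inj_on_le)
  then show ?thesis by (simp add: chromatic_symmetric_function_def)
qed

lemma m_expansion_chromatic:
  assumes G: "graph G"
  shows "m_expansion (chromatic_symmetric_function G)
           (\<lambda>\<nu>. chromatic_symmetric_function G (leading_monomial \<nu>))"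
  unfolding m_expansion_def
proof
  fix M
  interpret graph G by fact
  let ?X = "chromatic_symmetric_function G"
  show "?X M = (\<Sum>\<nu> | is_partition \<nu> \<and> monomial_symmetric_function \<nu> M \<noteq> 0.
      ?X (leading_monomial \<nu>) * monomial_symmetric_function \<nu> M)"
  proof (cases "set_mset M \<subseteq> {1..}")
    case True
    define \<nu> where "\<nu> = rev (sorted_list_of_multiset (exponents M))"
    have ms: "exponents M = mset \<nu>" by (simp add: \<nu>_def)
    have "0 < p" if "p \<in> set \<nu>" for p
    proof -
      have "p \<in># exponents M" using that by (simp add: ms)
      then show ?thesis by (auto simp: exponents_def)
    qed
    moreover have "sorted_wrt (\<ge>) \<nu>"
      by (simp add: \<nu>_def sorted_wrt_rev sorted_sorted_list_of_multiset)
    ultimately have part: "is_partition \<nu>" by (simp add: is_partition_def)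
    have "set_mset (leading_monomial \<nu>) \<subseteq> {1..}" using set_leading_monomial [OF part] by auto
    then have "?X M = ?X (leading_monomial \<nu>)"
      using chromatic_symmetric_function_le [OF G] True ms exponents_leading_monomial [OF part]
      by (metis order_antisym)
    then show ?thesis using m_expansion_sum [OF part True ms] by simp
  next
    case False
    have "{\<kappa> \<in> proper_colorings G. image_mset \<kappa> (mset_set (verts G)) = M} = {}"
      using False by (auto simp: proper_colorings_def)
    then have "?X M = 0" by (simp only: chromatic_symmetric_function_def card.empty of_nat_0)
    then show ?thesis using False by (simp add: monomial_symmetric_function_def)
  qed
qed

lemma m_coeff_chromatic:
  assumes "graph G" "is_partition \<nu>"
  shows "m_coeff \<nu> (chromatic_symmetric_function G) =
         chromatic_symmetric_function G (leading_monomial \<nu>)"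
  unfolding m_coeff_def
proof (rule the_equality)
  show "\<exists>c. m_expansion (chromatic_symmetric_function G) c \<and>
          c \<nu> = chromatic_symmetric_function G (leading_monomial \<nu>)"
    by (rule exI, rule conjI [OF m_expansion_chromatic [OF assms(1)] refl])
qed (auto dest: m_expansion_coeff [OF _ assms(2)])

end

theory Submission
  imports Defs
begin

text \<open>
  Two colour classes of a claw-free graph induce a bipartite graph of maximum degree 2, whose
  components are balanced up to 1. Recolouring such a component swaps its two sides, so the number
  of ways to split the two classes with a prescribed difference \<open>D\<close> of sizes is a power of 2 times
  a binomial coefficient and decreases in \<open>\<bar>D\<bar>\<close>. Hence moving a vertex from a larger class to one
  smaller by at least 2 does not decrease the number of colourings, and such moves lead from \<open>\<nu>\<close> to
  any \<open>\<mu> \<le> \<nu>\<close>. Conversely, the claw has a colouring of type \<open>(3, 1)\<close> but none of type \<open>(2, 2)\<close>.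
\<close>

section \<open>Splits of a vertex set into two stable sets\<close>

definition stable :: "('a \<times> 'a) set \<Rightarrow> 'a set \<Rightarrow> bool" where
  "stable E A \<longleftrightarrow> (\<forall>x\<in>A. \<forall>y\<in>A. (x, y) \<notin> E)"

text \<open>A proper 2-colouring of \<open>U\<close>, recorded by its first class; the two classes
  are thus ordered.\<close>

definition splits :: "('a \<times> 'a) set \<Rightarrow> 'a set \<Rightarrow> 'a set set" where
  "splits E U = {A. A \<subseteq> U \<and> stable E A \<and> stable E (U - A)}"

text \<open>A sum of signs in place of a difference of cardinalities: additive over components and
  negated by complementation.\<close>

definition excess :: "'a set \<Rightarrow> 'a set \<Rightarrow> int" where
  "excess U A = (\<Sum>x\<in>U. if x \<in> A then 1 else - 1)"

definition num_splits :: "('a \<times> 'a) set \<Rightarrow> 'a set \<Rightarrow> int \<Rightarrow> nat" where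
  "num_splits E U D = card {A \<in> splits E U. excess U A = D}"

text \<open>For symmetric \<open>E\<close> and a nonempty \<open>C\<close>, this is connectedness of the graph induced on \<open>C\<close>.\<close>

definition linked :: "('a \<times> 'a) set \<Rightarrow> 'a set \<Rightarrow> bool" where
  "linked E C \<longleftrightarrow> (\<forall>X \<subseteq> C. X \<noteq> {} \<and> E `` X \<inter> C \<subseteq> X \<longrightarrow> X = C)"

lemma stable_subset: "stable E A \<Longrightarrow> B \<subseteq> A \<Longrightarrow> stable E B"
  by (auto simp: stable_def)

lemma splits_Diff: "A \<in> splits E U \<Longrightarrow> U - A \<in> splits E U"
  by (auto simp: splits_def double_diff)

lemma finite_splits: "finite U \<Longrightarrow> finite (splits E U)"
  by (rule finite_subset [of _ "Pow U"]) (auto simp: splits_def)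

lemma excess_card:
  assumes "finite U" "A \<subseteq> U"
  shows "excess U A = int (card A) - int (card (U - A))"
proof -
  have "U \<inter> {x. x \<in> A} = A" "U \<inter> - {x. x \<in> A} = U - A" using assms by auto
  then show ?thesis using assms by (simp add: excess_def sum.If_cases)
qed

lemma excess_Diff: "excess U (U - A) = - excess U A"
  unfolding excess_def sum_negf [symmetric] by (rule sum.cong) auto

text \<open>A nonempty subset of \<open>U\<close> that is closed under adjacency within
  \<open>U\<close> and has least cardinality is connected.\<close>

lemma linked_component:
  assumes "finite U" "U \<noteq> {}"
  obtains C where "C \<subseteq> U" "C \<noteq> {}" "E `` C \<inter> U \<subseteq> C" "linked E C"
proof -
  let ?P = "\<lambda>X. X \<subseteq> U \<and> X \<noteq> {} \<and> E `` X \<inter> U \<subseteq> X"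
  have "?P U" using assms by auto
  then obtain C where C: "?P C" and min: "\<And>X. ?P X \<Longrightarrow> card C \<le> card X"
    using exists_least_iff [of "\<lambda>n. \<exists>X. ?P X \<and> card X = n"] by (metis linorder_not_le)
  have "X = C" if X: "X \<subseteq> C" "X \<noteq> {}" "E `` X \<inter> C \<subseteq> X" for X
  proof (rule card_seteq)
    show "finite C" using C assms(1) finite_subset by blast
    \<comment> \<open>Closed in \<open>C\<close> implies closed in \<open>U\<close>, because
      \<open>C\<close> is closed in \<open>U\<close>.\<close>
    have "?P X" using X C by blast
    then show "card C \<le> card X" by (rule min)
  qed (fact X(1))
  then have "linked E C" by (auto simp: linked_def)
  then show thesis using C that by blast
qed

text \<open>Grow a connected set one vertex at a time; each step adds at least one edge.\<close>

lemma linked_card_le: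
  assumes fin: "finite C" and linked: "linked E C" and sym: "sym E" and A: "A \<in> splits E C"
  shows "card C \<le> Suc (card (E \<inter> A \<times> (C - A)))"
proof (cases "C = {}")
  case False
  let ?e = "\<lambda>S. E \<inter> (A \<inter> S) \<times> (S - A)"
  have grow: "\<exists>S. S \<subseteq> C \<and> card S = Suc k \<and> card S \<le> Suc (card (?e S))" if "Suc k \<le> card C" for k
    using that
  proof (induction k)
    case 0
    obtain v where "v \<in> C" using False by blast
    then show ?case by (intro exI [of _ "{v}"]) auto
  next
    case (Suc k)
    then obtain S where S: "S \<subseteq> C" "card S = Suc k" "card S \<le> Suc (card (?e S))" by auto
    have finS: "finite S" using S(1) fin finite_subset by blast
    have "S \<noteq> {}" "S \<noteq> C" using S(2) Suc.prems by auto
    then obtain x y where xy: "x \<in> S" "y \<in> C" "y \<notin> S" "(x, y) \<in> E"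
      using linked S(1) unfolding linked_def by blast
    \<comment> \<open>The edge between \<open>S\<close> and the new vertex \<open>y\<close>,
      oriented from \<open>A\<close> to its complement so that each edge is counted once.\<close>
    define e where "e = (if x \<in> A then (x, y) else (y, x))"
    have "y \<in> A \<longleftrightarrow> x \<notin> A"
      using A xy S(1) unfolding splits_def stable_def by blast
    moreover have "(y, x) \<in> E" using xy(4) sym by (auto dest: symD)
    ultimately have "insert e (?e S) \<subseteq> ?e (insert y S)"
      using xy by (auto simp: e_def)
    moreover have "finite (?e (insert y S))" using finS by auto
    ultimately have "card (insert e (?e S)) \<le> card (?e (insert y S))"
      by (metis card_mono)
    moreover have "e \<notin> ?e S" using xy by (auto simp: e_def)
    moreover have "finite (?e S)" using finS by auto
    ultimately have "Suc (card (?e S)) \<le> card (?e (insert y S))" by simp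
    then show ?case
      using S xy finS by (intro exI [of _ "insert y S"]) auto
  qed
  have "card C > 0" using False fin by (simp add: card_gt_0_iff)
  then obtain S where S: "S \<subseteq> C" "card S = card C" "card S \<le> Suc (card (?e S))"
    using grow [of "card C - 1"] by auto
  then have "S = C" using fin by (simp add: card_subset_eq)
  moreover have "A \<inter> C = A" using A by (auto simp: splits_def)
  ultimately show ?thesis using S by simp
qed simp

text \<open>An edge changes sides in both of two splits. The set on which they agree is therefore
  closed under adjacency, hence empty or all of \<open>C\<close>.\<close>

lemma linked_splits:
  assumes linked: "linked E C" and A: "A \<in> splits E C" and sym: "sym E"
  shows "splits E C = {A, C - A}"
proof
  show "splits E C \<subseteq> {A, C - A}"
  proof
    fix B assume B: "B \<in> splits E C"
    let ?X = "{x \<in> C. x \<in> A \<longleftrightarrow> x \<in> B}"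
    have "y \<in> ?X" if "x \<in> ?X" "(x, y) \<in> E" "y \<in> C" for x y
    proof -
      have "y \<in> A \<longleftrightarrow> x \<notin> A" "y \<in> B \<longleftrightarrow> x \<notin> B"
        using that A B unfolding splits_def stable_def by blast+
      then show ?thesis using that by auto
    qed
    then have "E `` ?X \<inter> C \<subseteq> ?X" by blast
    then have "?X = {} \<or> ?X = C" using linked unfolding linked_def by (metis (no_types, lifting) mem_Collect_eq subsetI)
    then show "B \<in> {A, C - A}" using A B unfolding splits_def by blast
  qed
qed (use A splits_Diff in auto)

text \<open>Claw-freeness as it is used: no vertex has three pairwise non-adjacent neighbours. A
  bare relation lets the vertex set shrink in an induction without passing to subgraphs.\<close>

locale claw_free_relation =
  fixes E :: "('a \<times> 'a) set"
  assumes sym: "sym E"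
    and no_claw: "\<And>x S. finite S \<Longrightarrow> S \<subseteq> E `` {x} \<Longrightarrow> stable E S \<Longrightarrow> card S \<le> 2"
begin

text \<open>Each vertex of \<open>A\<close> has at most two neighbours in the stable set \<open>C - A\<close>, so there are at most
  \<open>2 * card A\<close> edges; by connectedness there are at least \<open>card C - 1\<close>.\<close>

lemma linked_excess_ge:
  assumes fin: "finite C" and "linked E C" and A: "A \<in> splits E C"
  shows "excess C A \<ge> - 1"
proof -
  have sub: "A \<subseteq> C" and finA: "finite A" using A fin by (auto simp: splits_def finite_subset)
  have "card (E \<inter> A \<times> (C - A)) = card (SIGMA x:A. E `` {x} \<inter> (C - A))"
    by (rule arg_cong [of _ _ card]) auto
  also have "\<dots> = (\<Sum>x\<in>A. card (E `` {x} \<inter> (C - A)))"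
    using fin finA by (subst card_SigmaI) auto
  also have "\<dots> \<le> (\<Sum>x\<in>A. 2)"
  proof (rule sum_mono)
    fix x
    show "card (E `` {x} \<inter> (C - A)) \<le> 2"
    proof (rule no_claw)
      show "stable E (E `` {x} \<inter> (C - A))"
        using A by (auto simp: splits_def intro: stable_subset)
    qed (use fin in auto)
  qed
  finally have "card C \<le> Suc (2 * card A)"
    using linked_card_le [OF fin assms(2) sym A] by simp
  moreover have "card C = card A + card (C - A)"
    using sub finA card_mono [OF fin sub] by (simp add: card_Diff_subset)
  ultimately show ?thesis using excess_card [OF fin sub] by simp
qed

text \<open>The lower bound also applies to the complementary split, whose excess is the
  negative.\<close>

lemma linked_abs_excess:
  assumes "finite C" "linked E C" "A \<in> splits E C"
  shows "\<bar>excess C A\<bar> \<le> 1"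
  using linked_excess_ge [OF assms] linked_excess_ge [OF assms(1,2) splits_Diff [OF assms(3)]]
  by (simp add: excess_Diff)

text \<open>There are no edges between \<open>C\<close> and \<open>U - C\<close>, so a split of
  \<open>U\<close> is a free combination of a split of each. The connected set \<open>C\<close> has
  only the splits \<open>A\<close> and \<open>C - A\<close>, of opposite excess; they give the two
  summands.\<close>

lemma num_splits_component:
  assumes fin: "finite U" and C: "C \<subseteq> U" "C \<noteq> {}" "E `` C \<inter> U \<subseteq> C" "linked E C"
    and A: "A \<in> splits E C"
  shows "num_splits E U D =
    num_splits E (U - C) (D - excess C A) + num_splits E (U - C) (D + excess C A)"
proof -
  have splits_U: "B \<in> splits E U \<longleftrightarrow> B \<subseteq> U \<and> B \<inter> C \<in> splits E C \<and> B - C \<in> splits E (U - C)" for B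
  proof
    assume "B \<in> splits E U"
    then show "B \<subseteq> U \<and> B \<inter> C \<in> splits E C \<and> B - C \<in> splits E (U - C)"
      using C(1) unfolding splits_def stable_def by blast
  next
    assume B: "B \<subseteq> U \<and> B \<inter> C \<in> splits E C \<and> B - C \<in> splits E (U - C)"
    have cross: "(x, y) \<notin> E" "(y, x) \<notin> E" if "x \<in> C" "y \<in> U - C" for x y
      using that C(3) sym by (auto dest: symD)
    have "(x, y) \<notin> E" if "x \<in> U" "y \<in> U" "x \<in> B \<longleftrightarrow> y \<in> B" for x y
    proof (cases "x \<in> C \<longleftrightarrow> y \<in> C")
      case True
      then show ?thesis using that B C(1) unfolding splits_def stable_def by blast
    next
      case False
      then show ?thesis using that cross by blast
    qed
    then show "B \<in> splits E U" using B by (auto simp: splits_def stable_def)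
  qed
  have excess_U: "excess U B = excess C (B \<inter> C) + excess (U - C) (B - C)" for B
  proof -
    have "excess U B = (\<Sum>x\<in>U - C. if x \<in> B then 1 else - 1) + (\<Sum>x\<in>C. if x \<in> B then 1 else - 1)"
      unfolding excess_def by (rule sum.subset_diff [OF C(1) fin])
    also have "(\<Sum>x\<in>U - C. if x \<in> B then 1 else - 1) = excess (U - C) (B - C)"
      unfolding excess_def by (rule sum.cong) auto
    also have "(\<Sum>x\<in>C. if x \<in> B then 1 else - 1) = excess C (B \<inter> C)"
      unfolding excess_def by (rule sum.cong) auto
    finally show ?thesis by simp
  qed
  let ?S = "\<lambda>A. {B \<in> splits E U. excess U B = D \<and> B \<inter> C = A}"
  have card_S: "card (?S A) = num_splits E (U - C) (D - excess C A)" if "A \<in> splits E C" for A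
    unfolding num_splits_def
  proof (rule bij_betw_same_card [of "\<lambda>B. B - C"], rule bij_betw_byWitness [where f' = "\<lambda>B. B \<union> A"])
    have AC: "A \<subseteq> C" using that by (simp add: splits_def)
    have *: "(B \<union> A) \<inter> C = A" "(B \<union> A) - C = B" if "B \<subseteq> U - C" for B
      using that AC by auto
    show "\<forall>B\<in>?S A. B - C \<union> A = B" by auto
    show "\<forall>B\<in>{B \<in> splits E (U - C). excess (U - C) B = D - excess C A}. B \<union> A - C = B"
      using * by (auto simp: splits_def)
    show "(\<lambda>B. B - C) ` ?S A \<subseteq> {B \<in> splits E (U - C). excess (U - C) B = D - excess C A}"
      using splits_U excess_U by auto
    show "(\<lambda>B. B \<union> A) ` {B \<in> splits E (U - C). excess (U - C) B = D - excess C A} \<subseteq> ?S A"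
    proof (rule image_subsetI)
      fix B assume B: "B \<in> {B \<in> splits E (U - C). excess (U - C) B = D - excess C A}"
      then have "B \<subseteq> U - C" by (auto simp: splits_def)
      moreover from this have "B \<union> A \<subseteq> U" using AC C(1) by auto
      ultimately show "B \<union> A \<in> ?S A"
        using B that * [of B] by (simp add: splits_U excess_U)
    qed
  qed
  have "B \<inter> C = A \<or> B \<inter> C = C - A" if "B \<in> splits E U" for B
    using that linked_splits [OF C(4) A sym] by (simp add: splits_U)
  then have "{B \<in> splits E U. excess U B = D} = ?S A \<union> ?S (C - A)" by auto
  \<comment> \<open>\<open>A\<close> and \<open>C - A\<close> differ because \<open>C\<close> is
    nonempty.\<close>
  moreover have "?S A \<inter> ?S (C - A) = {}" using C(2) A by (auto simp: splits_def)
  moreover have "finite (?S A)" "finite (?S (C - A))"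
    using finite_splits [OF fin] by auto
  ultimately have "num_splits E U D = card (?S A) + card (?S (C - A))"
    by (simp add: num_splits_def card_Un_disjoint)
  then show ?thesis
    using card_S [OF A] card_S [OF splits_Diff [OF A]] by (simp add: excess_Diff)
qed

text \<open>Induction that removes one component at a time. Parity enters because the excess of
  every split has the parity of \<open>card U\<close>.\<close>

lemma num_splits_mono:
  assumes "finite U" "\<bar>D'\<bar> \<le> \<bar>D\<bar>" "even (D - D')"
  shows "num_splits E U D \<le> num_splits E U D'"
  using assms
proof (induction U arbitrary: D D' rule: finite_psubset_induct)
  case (psubset U)
  show ?case
  proof (cases "U = {}")
    case True
    show ?thesis
    proof (cases "D = 0")
      case False
      then show ?thesis by (simp add: True num_splits_def excess_def)
    qed (use psubset.prems in auto)
  next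
    case False
    obtain C where C: "C \<subseteq> U" "C \<noteq> {}" "E `` C \<inter> U \<subseteq> C" "linked E C"
      using linked_component [OF psubset.hyps False] .
    have finC: "finite C" using C(1) psubset.hyps finite_subset by blast
    let ?g = "num_splits E (U - C)"
    have IH: "?g x \<le> ?g y" if "\<bar>y\<bar> \<le> \<bar>x\<bar>" "even (x - y)" for x y
      using psubset.IH [of "U - C" y x] C that by blast
    show ?thesis
    proof (cases "splits E C = {}")
      case True
      \<comment> \<open>If the component is not bipartite, \<open>U\<close> has no splits at
        all.\<close>
      have "A \<inter> C \<in> splits E C" if "A \<in> splits E U" for A
        using that C(1) unfolding splits_def stable_def by blast
      then have "splits E U = {}" using True by blast
      then show ?thesis by (simp add: num_splits_def)
    next
      case False
      then obtain A where A: "A \<in> splits E C" by blast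
      note rec = num_splits_component [OF psubset.hyps C A]
      consider "excess C A = 0" | "\<bar>excess C A\<bar> = 1"
        using linked_abs_excess [OF finC C(4) A] by linarith
      then show ?thesis
      proof cases
        case 1
        \<comment> \<open>A balanced component doubles the count at every \<open>D\<close>.\<close>
        then show ?thesis using rec IH [OF psubset.prems] by simp
      next
        case 2
        \<comment> \<open>Symmetry in the sign of the excess is the induction hypothesis applied in
          both directions.\<close>
        have even: "?g x = ?g (- x)" for x
          by (intro order_antisym IH) auto
        have rec1: "num_splits E U x = ?g (\<bar>x\<bar> - 1) + ?g (\<bar>x\<bar> + 1)" for x
        proof -
          have "excess C A = 1 \<or> excess C A = - 1" using 2 by linarith
          then have "num_splits E U x = ?g (x - 1) + ?g (x + 1)" using rec [of x] by auto
          then show ?thesis using even [of "x - 1"] even [of "x + 1"] by (cases "x \<ge> 0") auto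
        qed
        show ?thesis
        proof (cases "\<bar>D\<bar> = \<bar>D'\<bar>")
          case True
          then show ?thesis by (simp add: rec1)
        next
          case False
          \<comment> \<open>Distinct absolute values of equal parity are at least 2 apart, which
            leaves room for the crosswise comparison of the two summands.\<close>
          have par: "even (\<bar>D\<bar> - \<bar>D'\<bar>)" using psubset.prems(2) by (auto simp: abs_if)
          then have "\<bar>D\<bar> - \<bar>D'\<bar> \<noteq> 1" by (metis odd_one)
          then have "\<bar>D'\<bar> \<le> \<bar>D\<bar> - 2" using False psubset.prems(1) by linarith
          then have "?g (\<bar>D\<bar> - 1) \<le> ?g (\<bar>D'\<bar> + 1)" "?g (\<bar>D\<bar> + 1) \<le> ?g (\<bar>D'\<bar> - 1)"
            using par by (auto intro!: IH)
          then show ?thesis by (simp add: rec1)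
        qed
      qed
    qed
  qed
qed

end

section \<open>Colourings with prescribed class sizes\<close>

lemma card_le_by_fibers:
  assumes "finite S" "finite T"
    and "\<And>x. x \<in> S \<Longrightarrow> card {z \<in> S. g z = g x} \<le> card {z \<in> T. g z = g x}"
  shows "card S \<le> card T"
proof -
  let ?Y = "g ` S \<union> g ` T"
  have "card S = (\<Sum>y\<in>?Y. card {z \<in> S. g z = y})"
    using sum.group [of S ?Y g "\<lambda>_. 1::nat"] assms(1,2) by simp
  also have "\<dots> \<le> (\<Sum>y\<in>?Y. card {z \<in> T. g z = y})"
  proof (rule sum_mono)
    fix y
    show "card {z \<in> S. g z = y} \<le> card {z \<in> T. g z = y}"
    proof (cases "y \<in> g ` S")
      case True
      then show ?thesis using assms(3) by auto
    next
      case False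
      then have "{z \<in> S. g z = y} = {}" by auto
      then show ?thesis by (metis card.empty le0)
    qed
  qed
  also have "\<dots> = card T"
    using sum.group [of T ?Y g "\<lambda>_. 1::nat"] assms(1,2) by simp
  finally show ?thesis .
qed

text \<open>Class sizes are a function of the colour, so moving one vertex between classes is a
  function update.\<close>

definition colorings_of_type :: "('a, 'b) pre_digraph \<Rightarrow> (nat \<Rightarrow> nat) \<Rightarrow> ('a \<Rightarrow> nat) set" where
  "colorings_of_type G c =
     {\<kappa> \<in> proper_colorings G. \<forall>l. card {v \<in> verts G. \<kappa> v = l} = c l}"

lemma (in graph) chromatic_symmetric_function_eq:
  "chromatic_symmetric_function G M = int (card (colorings_of_type G (count M)))"
proof -
  have "count (image_mset \<kappa> (mset_set (verts G))) l = card {v \<in> verts G. \<kappa> v = l}" for \<kappa> :: "'a \<Rightarrow> nat" and l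
    by (simp add: count_image_mset Int_def conj_commute)
  then show ?thesis
    by (simp add: chromatic_symmetric_function_def colorings_of_type_def multiset_eq_iff)
qed

text \<open>\<open>c\<close> is arbitrary. A colouring uses exactly the colours in the support of
  \<open>c\<close>, so there is none if the support is infinite.\<close>

lemma (in graph) finite_colorings_of_type: "finite (colorings_of_type G c)"
proof (cases "finite {l. c l \<noteq> 0}")
  case True
  have "colorings_of_type G c \<subseteq> verts G \<rightarrow>\<^sub>E {l. c l \<noteq> 0}"
  proof
    fix \<kappa> assume k: "\<kappa> \<in> colorings_of_type G c"
    have "c (\<kappa> v) \<noteq> 0" if "v \<in> verts G" for v
    proof -
      have "card {w \<in> verts G. \<kappa> w = \<kappa> v} = c (\<kappa> v)" using k by (simp add: colorings_of_type_def)
      moreover have "{w \<in> verts G. \<kappa> w = \<kappa> v} \<noteq> {}" using that by blast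
      ultimately show ?thesis by (metis (no_types, lifting) card_0_eq finite_verts finite_subset mem_Collect_eq subsetI)
    qed
    then show "\<kappa> \<in> verts G \<rightarrow>\<^sub>E {l. c l \<noteq> 0}"
      using k by (auto simp: colorings_of_type_def proper_colorings_def PiE_def)
  qed
  moreover have "finite (verts G \<rightarrow>\<^sub>E {l. c l \<noteq> 0})"
    using True finite_verts by (intro finite_PiE)
  ultimately show ?thesis by (rule finite_subset)
next
  case False
  have "\<kappa> \<notin> colorings_of_type G c" for \<kappa>
  proof
    assume "\<kappa> \<in> colorings_of_type G c"
    then have "\<forall>l. card {v \<in> verts G. \<kappa> v = l} = c l" by (simp add: colorings_of_type_def)
    then have "{v \<in> verts G. \<kappa> v = l} \<noteq> {}" if "c l \<noteq> 0" for l
      using that by (metis (no_types, lifting) card.empty)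
    then have "{l. c l \<noteq> 0} \<subseteq> \<kappa> ` verts G" by blast
    then show False using False finite_subset by (metis finite_imageI finite_verts)
  qed
  then show ?thesis by (metis equals0I finite.emptyI)
qed

text \<open>Recolouring the vertices of colours \<open>i\<close> and \<open>j\<close>, with all other colours fixed, amounts to
  choosing another split of the set of these vertices.\<close>

lemma (in graph) card_colorings_of_type_move:
  assumes "claw_free_relation (arcs_ends G)" and ij: "i \<noteq> j" "1 \<le> i" "1 \<le> j" "c j + 2 \<le> c i"
  shows "card (colorings_of_type G c) \<le>
    card (colorings_of_type G (c(i := c i - 1, j := c j + 1)))"
proof -
  interpret claw_free_relation "arcs_ends G" by fact
  let ?c' = "c(i := c i - 1, j := c j + 1)"
  let ?S = "colorings_of_type G c" and ?S' = "colorings_of_type G ?c'"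
  \<comment> \<open>The key merges the colours \<open>i\<close> and \<open>j\<close> into 0, which
    is not a colour of any vertex. A fibre of \<open>key\<close> fixes all other colour
    classes.\<close>
  define key where "key \<kappa> v = (if \<kappa> v \<in> {i, j} then 0 else \<kappa> v)" for \<kappa> :: "'a \<Rightarrow> nat" and v
  show ?thesis
  proof (rule card_le_by_fibers [where g = key])
    fix \<kappa> assume k: "\<kappa> \<in> ?S"
    define U where "U = {v \<in> verts G. \<kappa> v \<in> {i, j}}"
    define D where "D = int (c i) - int (c j)"
    \<comment> \<open>The recolouring of \<open>\<kappa>\<close> that gives \<open>i\<close> to the
      vertices in \<open>A\<close> and \<open>j\<close> to the rest of \<open>U\<close>.\<close>
    define F where "F A v = (if v \<in> U then if v \<in> A then i else j else \<kappa> v)" for A v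
    let ?T = "\<lambda>D. {A \<in> splits (arcs_ends G) U. excess U A = D}"
    have proper: "\<kappa> \<in> proper_colorings G"
      and color_class: "\<And>l. card {v \<in> verts G. \<kappa> v = l} = c l"
      using k by (auto simp: colorings_of_type_def)
    have finU: "finite U" by (simp add: U_def)
    have cardU: "card U = c i + c j"
    proof -
      have "U = {v \<in> verts G. \<kappa> v = i} \<union> {v \<in> verts G. \<kappa> v = j}" by (auto simp: U_def)
      then show ?thesis using ij(1) by (simp add: color_class [symmetric] card_Un_disjoint disjoint_iff)
    qed
    have "{z \<in> ?S. key z = key \<kappa>} \<subseteq> F ` ?T D"
    proof
      fix z assume z: "z \<in> {z \<in> ?S. key z = key \<kappa>}"
      then have zS: "z \<in> proper_colorings G" and zc: "\<And>l. card {v \<in> verts G. z v = l} = c l"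
        and zk: "\<And>v. key z v = key \<kappa> v" by (auto simp: colorings_of_type_def)
      \<comment> \<open>Colours are positive, so the key is 0 at a vertex exactly when its colour is
        \<open>i\<close> or \<open>j\<close>.\<close>
      have pos: "z v \<noteq> 0" "\<kappa> v \<noteq> 0" if "v \<in> verts G" for v
        using zS proper that by (auto simp: proper_colorings_def dest!: PiE_mem)
      have zU: "z v \<in> {i, j} \<longleftrightarrow> v \<in> U" "v \<notin> U \<Longrightarrow> z v = \<kappa> v" if "v \<in> verts G" for v
        using zk [of v] pos [OF that] that by (auto simp: key_def U_def split: if_splits)
      let ?A = "{v \<in> U. z v = i}"
      have UA: "?A = {v \<in> verts G. z v = i}" "U - ?A = {v \<in> verts G. z v = j}"
        using zU ij(1) by (auto simp: U_def)
      have "stable (arcs_ends G) {v \<in> verts G. z v = l}" for l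
        using zS by (auto simp: stable_def proper_colorings_def)
      then have "stable (arcs_ends G) ?A \<and> stable (arcs_ends G) (U - ?A)"
        unfolding UA(2) unfolding UA(1) by blast
      then have "?A \<in> splits (arcs_ends G) U" by (simp add: splits_def)
      moreover have "excess U ?A = D"
      proof -
        have "excess U ?A = int (card ?A) - int (card (U - ?A))"
          by (rule excess_card [OF finU]) auto
        then show ?thesis unfolding UA(2) unfolding UA(1) by (simp add: zc D_def)
      qed
      moreover have "z = F ?A"
      proof
        fix v
        show "z v = F ?A v"
        proof (cases "v \<in> verts G")
          case True
          then show ?thesis using zU [OF True] by (auto simp: F_def)
        next
          case False
          then show ?thesis
            using zS proper by (auto simp: F_def U_def proper_colorings_def dest!: PiE_arb)
        qed
      qed
      ultimately show "z \<in> F ` ?T D" by blast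
    qed
    then have "card {z \<in> ?S. key z = key \<kappa>} \<le> card (F ` ?T D)"
      using finite_splits [OF finU] by (intro card_mono) auto
    also have "\<dots> \<le> num_splits (arcs_ends G) U D"
      unfolding num_splits_def using finite_splits [OF finU] by (intro card_image_le) auto
    \<comment> \<open>Moving one vertex lowers the difference of the class sizes by 2;
      \<open>D \<ge> 2\<close> gives \<open>\<bar>D - 2\<bar> \<le> \<bar>D\<bar>\<close>.\<close>
    also have "\<dots> \<le> num_splits (arcs_ends G) U (D - 2)"
      using ij(4) by (intro num_splits_mono finU) (auto simp: D_def)
    also have "\<dots> = card (F ` ?T (D - 2))"
      unfolding num_splits_def
    proof (rule card_image [symmetric], rule inj_onI)
      fix A B assume AB: "A \<in> ?T (D - 2)" "B \<in> ?T (D - 2)" "F A = F B"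
      have "X = {v \<in> U. F X v = i}" if "X \<subseteq> U" for X
        using that ij(1) by (auto simp: F_def)
      moreover have "A \<subseteq> U" "B \<subseteq> U" using AB by (auto simp: splits_def)
      ultimately show "A = B" using AB(3) by metis
    qed
    also have "\<dots> \<le> card {z \<in> ?S'. key z = key \<kappa>}"
    proof (rule card_mono)
      show "finite {z \<in> ?S'. key z = key \<kappa>}" by (simp add: finite_colorings_of_type)
      show "F ` ?T (D - 2) \<subseteq> {z \<in> ?S'. key z = key \<kappa>}"
      proof (rule image_subsetI)
        fix A assume A: "A \<in> ?T (D - 2)"
        then have sub: "A \<subseteq> U" and st: "stable (arcs_ends G) A" "stable (arcs_ends G) (U - A)"
          by (auto simp: splits_def)
        have "card U = card A + card (U - A)"
          using sub finU card_mono [OF finU sub] finite_subset [OF sub finU]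
          by (simp add: card_Diff_subset)
        \<comment> \<open>The sum \<open>c i + c j\<close> and the difference \<open>D - 2\<close>
          determine both cardinalities.\<close>
        then have cards: "card A = c i - 1" "card (U - A) = c j + 1"
          using A excess_card [OF finU sub] cardU ij(4) by (auto simp: D_def)
        have "{v \<in> verts G. F A v = i} = A" "{v \<in> verts G. F A v = j} = U - A"
          using sub ij(1) by (auto simp: F_def U_def)
        moreover have "{v \<in> verts G. F A v = l} = {v \<in> verts G. \<kappa> v = l}" if "l \<noteq> i" "l \<noteq> j" for l
          using that by (auto simp: F_def U_def)
        ultimately have "card {v \<in> verts G. F A v = l} = ?c' l" for l
          using cards color_class ij(1) by simp
        moreover have "F A \<in> proper_colorings G"
        proof -
          have "F A \<in> verts G \<rightarrow>\<^sub>E {1..}"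
            using proper ij by (auto simp: F_def U_def proper_colorings_def PiE_def Pi_def extensional_def)
          moreover have "F A u \<noteq> F A v" if uv: "(u, v) \<in> arcs_ends G" for u v
          proof -
            have V: "u \<in> verts G" "v \<in> verts G" using adj_in_verts [OF uv] .
            have "\<kappa> u \<noteq> \<kappa> v" using uv proper by (auto simp: proper_colorings_def)
            moreover have "u \<in> A \<longleftrightarrow> v \<notin> A" if "u \<in> U" "v \<in> U"
              using st uv that by (auto simp: stable_def)
            ultimately show ?thesis using V ij(1) by (auto simp: F_def U_def)
          qed
          ultimately show ?thesis by (auto simp: proper_colorings_def)
        qed
        moreover have "key (F A) = key \<kappa>"
          using ij by (auto simp: fun_eq_iff key_def F_def U_def)
        ultimately show "F A \<in> {z \<in> ?S'. key z = key \<kappa>}"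
          by (simp add: colorings_of_type_def)
      qed
    qed
    finally show "card {z \<in> ?S. key z = key \<kappa>} \<le> card {z \<in> ?S'. key z = key \<kappa>}" .
  qed (rule finite_colorings_of_type)+
qed

section \<open>Dominance order and moves of single units\<close>

text \<open>Only \<open>m\<close> has to be decreasing, so the intermediate functions need not be sorted.\<close>

lemma dominance_transfer_induct:
  fixes F :: "(nat \<Rightarrow> nat) \<Rightarrow> nat"
  assumes step: "\<And>c i j. \<lbrakk>i \<noteq> j; 1 \<le> i; 1 \<le> j; c j + 2 \<le> c i\<rbrakk> \<Longrightarrow> F c \<le> F (c(i := c i - 1, j := c j + 1))"
    and dec: "\<And>i j. \<lbrakk>1 \<le> i; i \<le> j\<rbrakk> \<Longrightarrow> m j \<le> m i"
    and "c 0 = m 0" "\<And>l. l > n \<Longrightarrow> c l = m l" "\<And>k. sum m {..k} \<le> sum c {..k}" "sum m {..n} = sum c {..n}"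
  shows "F c \<le> F m"
  using assms(3-)
\<comment> \<open>The measure is the total surplus of \<open>c\<close> over \<open>m\<close>:
  truncated subtraction ignores the deficient positions.\<close>
proof (induction "\<Sum>l\<le>n. c l - m l" arbitrary: c rule: less_induct)
  case less
  show ?case
  proof (cases "c = m")
    case False
    have "\<exists>j. c j < m j"
    proof (rule ccontr)
      assume "\<not> (\<exists>j. c j < m j)"
      then have ge: "m l \<le> c l" for l by (simp add: not_less)
      obtain l where l: "c l \<noteq> m l" using False by blast
      then have "m l < c l" "l \<le> n"
        using ge [of l] less.prems(2) [of l] linorder_not_le by (simp, blast)
      then have "sum m {..n} < sum c {..n}"
        using ge by (intro sum_strict_mono_ex1) auto
      then show False using less.prems(4) by simp
    qed
    \<comment> \<open>\<open>j\<close> is the first deficient position. Some earlier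
      \<open>i\<close> has a surplus, since otherwise the prefix sum up to \<open>j\<close> would
      violate dominance.\<close>
    then obtain j where "c j < m j \<and> (\<forall>l<j. \<not> c l < m l)"
      using exists_least_iff [of "\<lambda>j. c j < m j"] by blast
    then have j: "c j < m j" "\<And>l. l < j \<Longrightarrow> m l \<le> c l" by (auto simp: not_less)
    have "\<exists>i<j. m i < c i"
    proof (rule ccontr)
      assume "\<not> (\<exists>i<j. m i < c i)"
      then have "sum c {..<j} \<le> sum m {..<j}" by (intro sum_mono) (meson lessThan_iff not_le)
      then have "sum c {..j} < sum m {..j}" using j(1) by (simp add: lessThan_Suc_atMost [symmetric])
      then show False using less.prems(3) [of j] by simp
    qed
    then obtain i where i: "i < j" "m i < c i" by blast
    have "i \<noteq> 0" using i(2) less.prems(1) by (metis less_irrefl)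
    have jn: "j \<le> n" using j(1) less.prems(2) [of j] by (metis linorder_not_le less_irrefl)
    have "m j \<le> m i" using dec i \<open>i \<noteq> 0\<close> by simp
    \<comment> \<open>\<open>c j < m j \<le> m i < c i\<close>, with both inequalities at the ends
      strict.\<close>
    then have gap: "c j + 2 \<le> c i" using i j by simp
    define c' where "c' = c(i := c i - 1, j := c j + 1)"
    have sum_c': "sum c' {..k} = (if i \<le> k \<and> k < j then sum c {..k} - 1 else sum c {..k})" for k
    proof -
      \<comment> \<open>Stated additively to avoid truncated subtraction.\<close>
      have upd: "sum (f(x := y)) {..k} + f x = sum f {..k} + y" if "x \<le> k" for f :: "nat \<Rightarrow> nat" and x y
      proof -
        have "sum f {..k} = f x + sum f ({..k} - {x})" "sum (f(x := y)) {..k} = y + sum (f(x := y)) ({..k} - {x})"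
          using that sum.remove [of "{..k}" x f] sum.remove [of "{..k}" x "f(x := y)"] by auto
        moreover have "sum (f(x := y)) ({..k} - {x}) = sum f ({..k} - {x})" by (rule sum.cong) auto
        ultimately show ?thesis by simp
      qed
      have upd': "sum (f(x := y)) {..k} = sum f {..k}" if "\<not> x \<le> k" for f :: "nat \<Rightarrow> nat" and x y
        using that by (intro sum.cong) auto
      show ?thesis
        using upd [of i c "c i - 1"] upd' [of i c "c i - 1"]
          upd [of j "c(i := c i - 1)" "c j + 1"] upd' [of j "c(i := c i - 1)" "c j + 1"] i(1) gap
        by (auto simp: c'_def)
    qed
    have "(\<Sum>l\<le>n. c' l - m l) < (\<Sum>l\<le>n. c l - m l)"
    proof (rule sum_strict_mono_ex1)
      show "\<forall>l\<in>{..n}. c' l - m l \<le> c l - m l" using j(1) by (auto simp: c'_def)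
      show "\<exists>l\<in>{..n}. c' l - m l < c l - m l"
        using i jn by (intro bexI [of _ i]) (auto simp: c'_def)
    qed simp
    moreover have "c' 0 = m 0" using less.prems(1) i \<open>i \<noteq> 0\<close> by (auto simp: c'_def)
    moreover have "c' l = m l" if "l > n" for l
      using that jn i(1) less.prems(2) by (auto simp: c'_def)
    moreover have "sum m {..k} \<le> sum c' {..k}" for k
    proof (cases "i \<le> k \<and> k < j")
      case True
      \<comment> \<open>Before \<open>j\<close> no position is deficient, and \<open>i\<close> has a
        surplus, so the prefix sum can lose 1.\<close>
      then have "sum m {..k} < sum c {..k}"
        using i j(2) by (intro sum_strict_mono_ex1) auto
      then show ?thesis using True by (simp add: sum_c')
    next
      case False
      then show ?thesis using less.prems(3) [of k] by (simp only: sum_c' if_False)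
    qed
    moreover have "sum m {..n} = sum c' {..n}" using less.prems(4) jn by (simp add: sum_c')
    ultimately have "F c' \<le> F m" by (rule less.hyps)
    moreover have "F c \<le> F c'"
      unfolding c'_def using i(1) \<open>i \<noteq> 0\<close> gap by (intro step) auto
    ultimately show ?thesis by simp
  qed simp
qed

text \<open>Turns dominance of partitions into the prefix-sum conditions of
  \<open>dominance_transfer_induct\<close>. Index 0 contributes nothing.\<close>

lemma sum_count_leading_monomial:
  "(\<Sum>l\<le>k. count (leading_monomial \<nu>) l) = sum_list (take k \<nu>)"
proof (induction k)
  case (Suc k)
  then show ?case
    by (cases "k < length \<nu>") (simp_all add: count_leading_monomial take_Suc_conv_app_nth)
qed (simp add: count_leading_monomial)

lemma count_leading_monomial_decreasing:
  assumes "is_partition \<nu>" "1 \<le> i" "i \<le> j"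
  shows "count (leading_monomial \<nu>) j \<le> count (leading_monomial \<nu>) i"
proof (cases "i < j \<and> j \<le> length \<nu>")
  case True
  then have "\<nu> ! (j - 1) \<le> \<nu> ! (i - 1)"
    using assms by (auto simp: is_partition_def intro!: sorted_wrt_nth_less [of "(\<ge>)" \<nu>, simplified])
  then show ?thesis using True assms by (simp add: count_leading_monomial)
next
  case False
  then show ?thesis using assms by (cases "i = j") (auto simp: count_leading_monomial)
qed

text \<open>Each coefficient counts the colourings whose \<open>l\<close>-th class has the size of
  the \<open>l\<close>-th part, so the transfer induction applies to these counts.\<close>

lemma (in graph) strongly_nice_if_claw_free_relation:
  assumes "claw_free_relation (arcs_ends G)"
  shows "strongly_nice G"
  unfolding strongly_nice_def
proof (intro allI impI)
  fix \<nu> \<mu> assume *: "is_partition \<nu> \<and> is_partition \<mu> \<and> dominance_le \<mu> \<nu>"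
  let ?c = "count (leading_monomial \<nu>)" and ?m = "count (leading_monomial \<mu>)"
  \<comment> \<open>Beyond \<open>?n\<close> both counts vanish, and the prefix sums up to
    \<open>?n\<close> are the full sums.\<close>
  let ?n = "length \<nu> + length \<mu>"
  have "card (colorings_of_type G ?c) \<le> card (colorings_of_type G ?m)"
  proof (rule dominance_transfer_induct
      [where F = "\<lambda>c. card (colorings_of_type G c)" and c = ?c and m = ?m and n = ?n])
    show "sum ?m {..k} \<le> sum ?c {..k}" for k
      unfolding sum_count_leading_monomial using * by (cases "k = 0") (auto simp: dominance_le_def)
    show "sum ?m {..?n} = sum ?c {..?n}"
      using * by (simp add: sum_count_leading_monomial dominance_le_def)
  qed (use * card_colorings_of_type_move [OF assms] count_leading_monomial_decreasing
      in \<open>auto simp: count_leading_monomial\<close>)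
  then show "m_coeff \<mu> (chromatic_symmetric_function G) \<ge> m_coeff \<nu> (chromatic_symmetric_function G)"
    using * by (simp add: m_coeff_chromatic [OF graph_axioms] chromatic_symmetric_function_eq)
qed

section \<open>Induced subgraphs and the claw\<close>

lemma induced_subgraph_arcs_ends:
  assumes "induced_subgraph H G"
  shows "arcs_ends H = arcs_ends G \<inter> verts H \<times> verts H"
  using assms by (auto simp: induced_subgraph_def subgraph_def compatible_def arcs_ends_conv
      image_iff dest: wf_digraph.tail_in_verts wf_digraph.head_in_verts)

lemma induced_subgraph_trans:
  assumes "induced_subgraph K H" "induced_subgraph H G"
  shows "induced_subgraph K G"
  using assms by (auto simp: induced_subgraph_def subgraph_def compatible_def)

lemma (in graph) graph_induced_subgraph:
  assumes "induced_subgraph H G"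
  shows "graph H"
proof -
  have sub: "subgraph H G" using assms by (simp add: induced_subgraph_def)
  interpret H: digraph H by (rule digraph_subgraph [OF sub])
  have "symmetric H"
    using sym_arcs by (auto simp: symmetric_def induced_subgraph_arcs_ends [OF assms] sym_def)
  then show ?thesis by (rule H.graphI)
qed

text \<open>Three elements of a larger \<open>S\<close> would induce a claw with centre
  \<open>x\<close>.\<close>

lemma (in graph) claw_free_relation_arcs_ends:
  assumes "claw_free G"
  shows "claw_free_relation (arcs_ends G)"
proof
  show "sym (arcs_ends G)" using sym_arcs by (simp add: symmetric_def)
  fix x S assume S: "finite S" "S \<subseteq> arcs_ends G `` {x}" "stable (arcs_ends G) S"
  show "card S \<le> 2"
  proof (rule ccontr)
    assume "\<not> card S \<le> 2"
    then obtain L where L: "L \<subseteq> S" "card L = 3" "finite L"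
      using obtain_subset_with_card_n [of 3 S] by auto
    let ?H = "G \<restriction> insert x L"
    have adj: "(x, y) \<in> arcs_ends G" "(y, x) \<in> arcs_ends G" if "y \<in> L" for y
      using that S(2) L(1) by (auto intro: graph_symmetric)
    have V: "insert x L \<subseteq> verts G"
    proof -
      have "L \<noteq> {}" using L(2) by auto
      then show ?thesis using adj adj_in_verts by blast
    qed
    have nx: "x \<notin> L" using adj adj_not_same by blast
    have ind: "induced_subgraph ?H G" using V by (rule induced_induce)
    have "(x, x) \<notin> arcs_ends G" using adj_not_same by blast
    moreover have "(y, z) \<notin> arcs_ends G" if "y \<in> L" "z \<in> L" for y z
      using that S(3) L(1) by (auto simp: stable_def)
    ultimately have "arcs_ends ?H = {x} \<times> L \<union> L \<times> {x}"
      unfolding induced_subgraph_arcs_ends [OF ind] using adj by auto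
    then have "K\<^bsub>1,3\<^esub> ?H"
      unfolding complete_bipartite_digraph_def using nx L(2)
      by (intro conjI exI [of _ "{x}"] exI [of _ L] graph_induced_subgraph [OF ind]) simp_all
    then show False using assms ind by (auto simp: claw_free_def)
  qed
qed

text \<open>The centre is adjacent to all other vertices, so its colour class is a singleton, which
  type (2, 2) excludes. Type (3, 1) is attained with colour 1 on the leaves and colour 2 on the
  centre.\<close>

lemma claw_not_strongly_nice:
  assumes "K\<^bsub>1,3\<^esub> H"
  shows "\<not> strongly_nice H"
proof
  assume nice: "strongly_nice H"
  interpret graph H using assms by (simp add: complete_bipartite_digraph_def)
  obtain U L where UL: "verts H = U \<union> L" "U \<inter> L = {}" "card U = 1" "card L = 3"
      "arcs_ends H = U \<times> L \<union> L \<times> U"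
    using assms by (auto simp: complete_bipartite_digraph_def)
  obtain x where x: "U = {x}" using UL(3) by (auto simp: card_1_singleton_iff)
  let ?c = "\<lambda>\<nu>. card (colorings_of_type H (count (leading_monomial \<nu>)))"
  have part: "is_partition [3, 1]" "is_partition [2, 2]"
    by (auto simp: is_partition_def)
  have "dominance_le [2, 2] [3, 1]"
  proof -
    have "sum_list (take k [2, 2]) \<le> sum_list (take k [3, 1 :: nat])" for k
      by (simp add: take_Cons')
    then show ?thesis by (simp add: dominance_le_def)
  qed
  then have "?c [3, 1] \<le> ?c [2, 2]"
    using nice part
    by (simp add: strongly_nice_def m_coeff_chromatic [OF graph_axioms] chromatic_symmetric_function_eq)
  moreover have "colorings_of_type H (count (leading_monomial [2, 2])) = {}"
  proof -
    have False if "\<kappa> \<in> colorings_of_type H (count (leading_monomial [2, 2]))" for \<kappa>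
    proof -
      have "\<kappa> y \<noteq> \<kappa> x" if "y \<in> L" for y
        using that \<open>\<kappa> \<in> _\<close> UL(5) x by (auto simp: colorings_of_type_def proper_colorings_def)
      then have eq: "{v \<in> verts H. \<kappa> v = \<kappa> x} = {x}" using UL(1) x by auto
      have "count (leading_monomial [2, 2]) (\<kappa> x) = card {v \<in> verts H. \<kappa> v = \<kappa> x}"
        using that by (simp add: colorings_of_type_def)
      also have "\<dots> = 1" unfolding eq by simp
      finally have "count (leading_monomial [2, 2]) (\<kappa> x) = 1" .
      moreover have "count (leading_monomial [2, 2]) l \<noteq> 1" for l
        by (simp add: count_leading_monomial nth_Cons')
      ultimately show False by blast
    qed
    then show ?thesis by blast
  qed
  moreover have "restrict (\<lambda>v. if v = x then 2 else 1) (verts H)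
      \<in> colorings_of_type H (count (leading_monomial [3, 1]))" (is "?\<kappa> \<in> _")
  proof -
    have "{v \<in> verts H. ?\<kappa> v = l} = (if l = 1 then L else if l = 2 then {x} else {})" for l
      using UL x by auto
    then have "card {v \<in> verts H. ?\<kappa> v = l} = count (leading_monomial [3, 1]) l" for l
      using UL(4) by (simp add: count_leading_monomial nth_Cons')
    moreover have "?\<kappa> \<in> proper_colorings H"
      using UL x by (auto simp: proper_colorings_def)
    ultimately show ?thesis by (simp only: colorings_of_type_def mem_Collect_eq) blast
  qed
  ultimately show False
    using finite_colorings_of_type by (metis card_0_eq card.empty empty_iff le_zero_eq)
qed

theorem theorem3p1:
  fixes G :: "('a, 'b) pre_digraph"
  assumes "graph G"
  shows "claw_free G \<longleftrightarrow>
    strongly_nice G \<and> (\<forall>H. induced_subgraph H G \<longrightarrow> strongly_nice H)"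
proof
  interpret graph G by fact
  assume free: "claw_free G"
  have "strongly_nice H" if "induced_subgraph H G" for H
  proof -
    interpret H: graph H using that by (rule graph_induced_subgraph)
    have "claw_free H"
      using free induced_subgraph_trans [OF _ that] by (auto simp: claw_free_def)
    then show ?thesis
      by (intro H.strongly_nice_if_claw_free_relation H.claw_free_relation_arcs_ends)
  qed
  then show "strongly_nice G \<and> (\<forall>H. induced_subgraph H G \<longrightarrow> strongly_nice H)"
    using strongly_nice_if_claw_free_relation [OF claw_free_relation_arcs_ends [OF free]] by blast
next
  assume "strongly_nice G \<and> (\<forall>H. induced_subgraph H G \<longrightarrow> strongly_nice H)"
  \<comment> \<open>An induced claw would itself be an induced subgraph that is not strongly
    nice.\<close>
  then show "claw_free G" using claw_not_strongly_nice by (auto simp: claw_free_def)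
qed

end
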